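(* Let $n\ge2$ and let $L=D_n^*$ be the dual lattice of $D_n$, so that $L^*=D_n$. Put $$\alpha=\max\left\{\frac{|x|^2}{2\sum_{u\in R(D_n)}(1-\cos(2\pi u^{\mathsf T}x))} : x\in V(L)\setminus\{0\}\right\},\qquad C=16\pi^2(n-1)\,\alpha,$$ and define $z:D_n\to\mathbb{R}$ by $z(u)=\alpha$ if $u\in R(D_n)$ and $z(u)=0$ otherwise. Then $(C,z)$ is an optimal solution of the program (P) for $L=D_n^*$.
   Context: $D_n=\{u\in\mathbb{Z}^n:\sum_{i=1}^n u_i\text{ is even}\}$, and $R(D_n)=\{\pm(e_i\pm e_j):i\ne j\}$ is the set of its roots (vectors of squared length $2$), where $e_1,\ldots,e_n$ is the standard basis of $\mathbb{R}^n$. For a lattice $L\subseteq\mathbb{R}^n$, the dual lattice is $L^*=\{u\in\mathbb{R}^n:u^{\mathsf T}v\in\mathbb{Z}\text{ for all }v\in L\}$ and the Voronoi cell is $V(L)=\{x\in\mathbb{R}^n:|x|\le|x-v|\text{ for all }v\in L\}$, with $|x|=\sqrt{x^{\mathsf T}x}$. $\ell^1(L^* )$ is the set of absolutely summable functions $L^*\to\mathbb{C}$; $\mathbb{R}_+$ denotes the nonnegative reals; $I$ is the $n\times n$ identity matrix; $\mathcal{S}^n_+$ is the cone of real symmetric positive semidefinite $n\times n$ matrices. Program (P) for $L$: minimize $C$ subject to $C\in\mathbb{R}_+$, $z\in\ell^1(L^* )$, $z(u)=z(-u)\ge0$ for all $u\in L^*$, $|x|^2\le2\sum_{u\in L^*}z(u)(1-\cos(2\pi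 u^{\mathsf T}x))$ for all $x\in V(L)$, and $CI-4\pi^2\sum_{u\in L^*}z(u)uu^{\mathsf T}\in\mathcal{S}^n_+$ (the last constraint includes convergence of the series). An optimal solution is a feasible pair $(C,z)$ with $C$ minimal; the optimal value of (P) is the square of the least distortion of an embedding of the flat torus $\mathbb{R}^n/L$ into a Hilbert space. *)

theory Defs
  imports "HOL-Analysis.Analysis"
begin

definition dual_lattice :: "(real^'n) set \<Rightarrow> (real^'n) set" where
  "dual_lattice L = {u. \<forall>v\<in>L. u \<bullet> v \<in> \<int>}"

definition voronoi_cell :: "(real^'n) set \<Rightarrow> (real^'n) set" where
  "voronoi_cell L = {x. \<forall>v\<in>L. norm x \<le> norm (x - v)}"

definition D_lattice :: "(real^'n) set" where
  "D_lattice = {(\<chi> i. real_of_int (u i)) | u :: 'n \<Rightarrow> int. even (\<Sum>i\<in>UNIV. u i)}"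

definition D_roots :: "(real^'n) set" where
  "D_roots = {s *\<^sub>R (axis i 1 + t *\<^sub>R axis j 1) | s t i j.
                s \<in> {1, -1} \<and> t \<in> {1, -1} \<and> i \<noteq> j}"

definition outer_square :: "real^'n \<Rightarrow> real^'n^'n" where
  "outer_square u = (\<chi> i j. u $ i * u $ j)"

definition psd_cone :: "(real^'n^'n) set" where
  "psd_cone = {A. transpose A = A \<and> (\<forall>x. 0 \<le> x \<bullet> (A *v x))}"

text \<open>
  Elements of $\ell^1(L^*)$ are represented by total functions; their values outside $L^*$ are
  never used. The third condition forces \<open>z\<close> to be real-valued on $L^*$, so \<open>Re (z u)\<close> is just
  \<open>z u\<close>. The series of matrices is required to converge unconditionally, as there is no preferred
  ordering of $L^*$; since \<open>infsum\<close> is 0 on non-summable families, this has to be stated explicitly.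
\<close>

definition feasible :: "(real^'n) set \<Rightarrow> real \<Rightarrow> (real^'n \<Rightarrow> complex) \<Rightarrow> bool" where
  "feasible L C z \<longleftrightarrow>
     0 \<le> C \<and>
     (\<lambda>u. norm (z u)) summable_on dual_lattice L \<and>
     (\<forall>u\<in>dual_lattice L. z u = z (- u) \<and> z u \<in> \<real>\<^sub>\<ge>\<^sub>0) \<and>
     (\<forall>x\<in>voronoi_cell L.
        (norm x)\<^sup>2 \<le> 2 * (\<Sum>\<^sub>\<infinity>u\<in>dual_lattice L. Re (z u) * (1 - cos (2 * pi * (u \<bullet> x))))) \<and>
     (\<lambda>u. Re (z u) *\<^sub>R outer_square u) summable_on dual_lattice L \<and>
     C *\<^sub>R mat 1 - (4 * pi\<^sup>2) *\<^sub>R (\<Sum>\<^sub>\<infinity>u\<in>dual_lattice L. Re (z u) *\<^sub>R outer_square u) \<in> psd_cone"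

definition optimal_solution :: "(real^'n) set \<Rightarrow> real \<Rightarrow> (real^'n \<Rightarrow> complex) \<Rightarrow> bool" where
  "optimal_solution L C z \<longleftrightarrow> feasible L C z \<and> (\<forall>C' z'. feasible L C' z' \<longrightarrow> C \<le> C')"

end

theory Submission
  imports Defs "HOL-Combinatorics.Permutations"
begin

text \<open>
  Write \<open>n\<close> for the dimension and \<open>E(x)\<close> (\<open>root_energy\<close>) for the sum of \<open>1 - cos (2 pi (u \<bullet> x))\<close> over the
  \<open>2 n (n - 1)\<close> roots \<open>u\<close>, so that \<open>\<alpha>\<close> is the maximum of \<open>(norm x)\<^sup>2 / (2 E(x))\<close> over the non-zero points of
  the Voronoi cell.

  Feasibility of the root weights is immediate: the outer squares of the roots add up to
  \<open>4 (n - 1)\<close> times the identity, so the matrix constraint holds with equality for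
  \<open>C = 16 pi\<^sup>2 (n - 1) \<alpha>\<close>, and the distance constraint says that \<open>\<alpha>\<close> bounds the ratios
  (\<open>root_weights_feasible\<close>).

  Optimality rests on symmetry. The group of signed permutations of the coordinates preserves
  \<open>D_lattice\<close>, its dual and the Voronoi cell. Let \<open>z\<close> be any feasible weight, with constant \<open>C\<close>, and let \<open>x\<close>
  lie in the Voronoi cell. Averaging the distance constraint over the orbit of \<open>x\<close> gives
  \<open>(norm x)\<^sup>2 \<le> 2 \<Sum> z(u) A(u)\<close>, where \<open>A(u)\<close> is the average of \<open>1 - cos (2 pi (u \<bullet> y))\<close> over that orbit. The
  key inequality, \<open>sum_signed_perm_one_minus_cos_le\<close>, is
  \<open>A(u) \<le> E(x) (norm u)\<^sup>2 / (4 n (n - 1))\<close> for all \<open>u\<close> in \<open>D_lattice\<close>. It reduces the weights to their second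
  moment \<open>\<Sum> z(u) (norm u)\<^sup>2\<close>, which is at most \<open>n C / (4 pi\<^sup>2)\<close> by the trace of the matrix constraint.
  Hence \<open>C \<ge> 16 pi\<^sup>2 (n - 1) (norm x)\<^sup>2 / (2 E(x))\<close> (\<open>feasible_lower_bound\<close>), and a maximizing \<open>x\<close> gives the
  claim.

  For the key inequality let \<open>u\<close> have the integer coordinates \<open>k i\<close>, and put \<open>\<theta> i = 2 pi x_i\<close>. Averaging
  over the signs turns \<open>cos (2 pi (u \<bullet> y))\<close> into the product of the \<open>cos (k i * \<theta> (p i))\<close>. Each factor is
  replaced by \<open>1\<close> or by \<open>cos (\<theta> (p i))\<close>, according to the parity of \<open>k i\<close>, at the price of a multiple of
  \<open>1 - (cos (\<theta> (p i)))\<^sup>2\<close>. The remaining product has an even number of factors, as the coordinate sum of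
  \<open>u\<close> is even, and splits into pairs. The average over the permutations bounds all these terms by the
  average of \<open>1 - cos (\<theta> i) * cos (\<theta> j)\<close> over \<open>i \<noteq> j\<close>, which is \<open>E(x) / (2 n (n - 1))\<close>.

  The maximum exists although the ratio is undefined at 0: the reciprocal ratio extends
  continuously to 0, and its value there is its largest one (\<open>ratio_attains_max\<close>).
\<close>

section \<open>Cosines of integer multiples\<close>

lemma abs_sin_int_mult_le:
  fixes k :: int and t :: real
  shows "\<bar>sin (of_int k * t)\<bar> \<le> \<bar>of_int k\<bar> * \<bar>sin t\<bar>"
proof -
  have nat_case: "\<bar>sin (real m * t)\<bar> \<le> real m * \<bar>sin t\<bar>" for m
  proof (induction m)
    case (Suc m)
    have "sin (real (Suc m) * t) = sin (real m * t) * cos t + cos (real m * t) * sin t"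
      by (simp add: algebra_simps sin_add)
    also have "\<bar>\<dots>\<bar> \<le> \<bar>sin (real m * t)\<bar> * \<bar>cos t\<bar> + \<bar>cos (real m * t)\<bar> * \<bar>sin t\<bar>"
      by (metis abs_mult abs_triangle_ineq)
    also have "\<dots> \<le> \<bar>sin (real m * t)\<bar> * 1 + 1 * \<bar>sin t\<bar>"
      by (intro add_mono mult_mono) auto
    also have "\<dots> \<le> real (Suc m) * \<bar>sin t\<bar>"
      using Suc by (simp add: algebra_simps)
    finally show ?case .
  qed simp
  show ?thesis
    using nat_case[of "nat \<bar>k\<bar>"] by (cases "k \<ge> 0") auto
qed

text \<open>
  The difference of the cosines is \<open>2 sin (q t) sin (p t)\<close> with \<open>q + p = k\<close> and \<open>q - p\<close> the parity of
  \<open>k\<close>, and \<open>\<bar>sin (p t)\<bar> \<le> \<bar>p\<bar> \<bar>sin t\<bar>\<close>. For odd \<open>k\<close> no multiple of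
  \<open>1 - (cos t)\<^sup>2\<close> bounds \<open>1 - cos (k t)\<close>, because \<open>cos (k pi) = -1\<close>; hence the comparison with \<open>cos t\<close>.
\<close>

lemma cos_int_mult_parity_bound:
  fixes k :: int and t :: real
  shows "\<bar>(if odd k then cos t else 1) - cos (of_int k * t)\<bar>
         \<le> (of_int k ^ 2 - of_bool (odd k)) / 2 * (1 - (cos t)\<^sup>2)"
proof -
  define e :: int where "e = of_bool (odd k)"
  obtain p where p: "k = 2 * p + e"
    unfolding e_def by (cases "even k") (auto elim!: oddE)
  define q where "q = p + e"
  \<comment> \<open>with \<open>e\<close> the parity of \<open>k\<close>, \<open>p = (k - e)/2\<close> and \<open>q = (k + e)/2\<close> are integers\<close>
  have "(if odd k then cos t else 1) = cos (of_int e * t)"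
    by (simp add: e_def)
  moreover have "cos (of_int e * t) - cos (of_int k * t) = 2 * sin (of_int q * t) * sin (of_int p * t)"
    by (subst cos_diff_cos) (simp add: p q_def algebra_simps add_divide_distrib)
  moreover have "\<bar>2 * sin (of_int q * t) * sin (of_int p * t)\<bar>
      \<le> 2 * (\<bar>of_int q\<bar> * \<bar>sin t\<bar>) * (\<bar>of_int p\<bar> * \<bar>sin t\<bar>)"
    unfolding abs_mult
    by (intro mult_mono abs_sin_int_mult_le) auto
  moreover have "2 * (\<bar>of_int q\<bar> * \<bar>sin t\<bar>) * (\<bar>of_int p\<bar> * \<bar>sin t\<bar>) = 2 * of_int \<bar>p * q\<bar> * (sin t)\<^sup>2"
    by (simp add: abs_mult power2_eq_square algebra_simps)
  moreover have "\<bar>p * q\<bar> = p * q"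
    using zero_le_mult_iff[of p q] unfolding q_def e_def by auto
  moreover have "2 * of_int (p * q) = (of_int k ^ 2 - of_bool (odd k)) / (2::real)"
    unfolding p q_def by (auto simp: e_def power2_eq_square algebra_simps)
  ultimately show ?thesis
    by (simp only: sin_squared_eq)
qed

text \<open>
  All factors have modulus at most 1, so the errors of replacing \<open>cos (k i * \<theta> i)\<close> by \<open>1\<close> or
  \<open>cos (\<theta> i)\<close> add up.
\<close>

lemma prod_cos_int_mult_bound:
  fixes k :: "'n::finite \<Rightarrow> int" and \<theta> :: "'n \<Rightarrow> real"
  shows "1 - (\<Prod>i\<in>UNIV. cos (of_int (k i) * \<theta> i))
    \<le> (1 - (\<Prod>i\<in>{i. odd (k i)}. cos (\<theta> i)))
      + (\<Sum>i\<in>UNIV. (of_int (k i) ^ 2 - of_bool (odd (k i))) / 2 * (1 - (cos (\<theta> i))\<^sup>2))"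
proof -
  have "\<bar>(\<Prod>i\<in>UNIV. if odd (k i) then cos (\<theta> i) else 1) - (\<Prod>i\<in>UNIV. cos (of_int (k i) * \<theta> i))\<bar>
     \<le> (\<Sum>i\<in>UNIV. \<bar>(if odd (k i) then cos (\<theta> i) else 1) - cos (of_int (k i) * \<theta> i)\<bar>)"
    using norm_prod_diff[of UNIV "\<lambda>i. if odd (k i) then cos (\<theta> i) else 1"
        "\<lambda>i. cos (of_int (k i) * \<theta> i)"] by simp
  also have "\<dots> \<le> (\<Sum>i\<in>UNIV. (of_int (k i) ^ 2 - of_bool (odd (k i))) / 2 * (1 - (cos (\<theta> i))\<^sup>2))"
    by (intro sum_mono cos_int_mult_parity_bound)
  moreover have "(\<Prod>i\<in>UNIV. if odd (k i) then cos (\<theta> i) else 1) = (\<Prod>i\<in>{i. odd (k i)}. cos (\<theta> i))"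
    by (simp add: prod.If_cases)
  ultimately show ?thesis
    by linarith
qed

section \<open>Averages over signed permutations\<close>

text \<open>
  The real part of the expansion of \<open>\<Prod>i. cis (a i) + cis (- a i)\<close> over the sets of coordinates that
  take the first summand.
\<close>

lemma sum_cos_all_signs:
  fixes a :: "'n::finite \<Rightarrow> real"
  shows "(\<Sum>X\<in>UNIV. cos (\<Sum>i\<in>UNIV. (if i \<in> X then a i else - a i)))
    = 2 ^ CARD('n) * (\<Prod>i\<in>UNIV. cos (a i))"
proof -
  have "(\<Sum>X\<in>UNIV. cis (\<Sum>i\<in>UNIV. (if i \<in> X then a i else - a i)))
     = (\<Sum>X\<in>Pow UNIV. (\<Prod>i\<in>X. cis (a i)) * (\<Prod>i\<in>UNIV - X. cis (- a i)))"
  proof (rule sum.cong)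
    fix X :: "'n set"
    have "cis (\<Sum>i\<in>UNIV. (if i \<in> X then a i else - a i)) = (\<Prod>i\<in>UNIV. cis (if i \<in> X then a i else - a i))"
      by (simp add: cis_conv_exp sum_distrib_left exp_sum)
    also have "\<dots> = (\<Prod>i\<in>UNIV. if i \<in> X then cis (a i) else cis (- a i))"
      by (intro prod.cong) auto
    also have "\<dots> = (\<Prod>i\<in>X. cis (a i)) * (\<Prod>i\<in>UNIV - X. cis (- a i))"
      by (simp add: prod.If_cases Compl_eq_Diff_UNIV)
    finally show "cis (\<Sum>i\<in>UNIV. (if i \<in> X then a i else - a i))
        = (\<Prod>i\<in>X. cis (a i)) * (\<Prod>i\<in>UNIV - X. cis (- a i))" .
  qed simp
  also have "\<dots> = (\<Prod>i\<in>UNIV. cis (a i) + cis (- a i))"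
    by (rule prod_add[symmetric]) simp
  also have "\<dots> = (\<Prod>i\<in>UNIV. complex_of_real (2 * cos (a i)))"
    by (intro prod.cong) (auto simp: complex_eq_iff)
  also have "\<dots> = complex_of_real (2 ^ CARD('n) * (\<Prod>i\<in>UNIV. cos (a i)))"
    by (simp add: prod.distrib)
  finally have "Re (\<Sum>X\<in>UNIV. cis (\<Sum>i\<in>UNIV. (if i \<in> X then a i else - a i)))
      = 2 ^ CARD('n) * (\<Prod>i\<in>UNIV. cos (a i))"
    by (simp only: Re_complex_of_real)
  then show ?thesis
    by (simp add: Re_sum)
qed

lemma sum_permutations_point:
  fixes f :: "'n::finite \<Rightarrow> real"
  shows "(\<Sum>p | p permutes UNIV. f (p i)) = (\<Sum>p | p permutes (UNIV::'n set). f (p j))"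
  by (subst sum_permutations_compose_right[of "Transposition.transpose i j"])
    (auto simp: permutes_swap_id)

lemma ex_permutation_pair:
  assumes "i \<noteq> j" "k \<noteq> l"
  shows "\<exists>p. p permutes UNIV \<and> p i = k \<and> p j = l"
proof -
  define r where "r = Transposition.transpose i k"
  define q where "q = Transposition.transpose (r j) l"
  have "r j \<noteq> k"
    using assms unfolding r_def by (auto simp: Transposition.transpose_def)
  then have "(q \<circ> r) i = k" "(q \<circ> r) j = l"
    using assms unfolding q_def by (auto simp: r_def Transposition.transpose_def)
  moreover have "(q \<circ> r) permutes UNIV"
    unfolding q_def r_def by (intro permutes_compose permutes_swap_id) auto
  ultimately show ?thesis
    by blast
qed

text \<open>
  The symmetric group is doubly transitive, so the sum depends on the pair of positions only through
  their being distinct.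
\<close>

lemma sum_permutations_pair:
  fixes f :: "'n::finite \<Rightarrow> 'n \<Rightarrow> real"
  assumes "i \<noteq> j" "k \<noteq> l"
  shows "(\<Sum>p | p permutes UNIV. f (p i) (p j)) = (\<Sum>p | p permutes (UNIV::'n set). f (p k) (p l))"
proof -
  obtain q where "q permutes UNIV" "q i = k" "q j = l"
    using ex_permutation_pair[OF assms] by blast
  then show ?thesis
    using sum_permutations_compose_right[of q UNIV "\<lambda>p. f (p i) (p j)"] by simp
qed

text \<open>
  Sum the previous identity over all ordered pairs of distinct positions; for each fixed permutation
  the pairs of their images again run over all such pairs.
\<close>

lemma sum_permutations_off_diagonal:
  fixes f :: "'n::finite \<Rightarrow> 'n \<Rightarrow> real"
  assumes "k \<noteq> l"
  shows "real CARD('n) * (real CARD('n) - 1) * (\<Sum>p | p permutes UNIV. f (p k) (p l))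
    = fact CARD('n) * (\<Sum>i\<in>UNIV. \<Sum>j\<in>-{i}. f i j)"
proof -
  have "(\<Sum>i\<in>UNIV. \<Sum>j\<in>-{i}. \<Sum>p | p permutes UNIV. f (p i) (p j))
      = (\<Sum>i\<in>(UNIV::'n set). \<Sum>j\<in>-{i}. \<Sum>p | p permutes UNIV. f (p k) (p l))"
  proof (rule sum.cong[OF refl], rule sum.cong[OF refl])
    fix i j :: 'n assume "j \<in> -{i}"
    then show "(\<Sum>p | p permutes UNIV. f (p i) (p j)) = (\<Sum>p | p permutes UNIV. f (p k) (p l))"
      by (intro sum_permutations_pair assms) auto
  qed
  also have "\<dots> = real CARD('n) * (real CARD('n) - 1) * (\<Sum>p | p permutes UNIV. f (p k) (p l))"
    by (simp add: Compl_eq_Diff_UNIV card_Diff_singleton of_nat_diff)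
  finally have "real CARD('n) * (real CARD('n) - 1) * (\<Sum>p | p permutes UNIV. f (p k) (p l))
      = (\<Sum>i\<in>UNIV. \<Sum>j\<in>-{i}. \<Sum>p | p permutes (UNIV::'n set). f (p i) (p j))"
    by simp
  also have "\<dots> = (\<Sum>i\<in>UNIV. \<Sum>p | p permutes (UNIV::'n set). \<Sum>j\<in>-{i}. f (p i) (p j))"
    by (intro sum.cong refl sum.swap)
  also have "\<dots> = (\<Sum>p | p permutes (UNIV::'n set). \<Sum>i\<in>UNIV. \<Sum>j\<in>-{i}. f (p i) (p j))"
    by (rule sum.swap)
  also have "\<dots> = (\<Sum>p | p permutes (UNIV::'n set). \<Sum>i\<in>UNIV. \<Sum>j\<in>-{i}. f i j)"
  proof (rule sum.cong)
    fix p :: "'n \<Rightarrow> 'n" assume "p \<in> {p. p permutes UNIV}"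
    then have "bij p"
      by (simp add: permutes_bij)
    have "bij_betw p (-{i}) (-{p i})" for i
      using bij_image_Compl_eq[OF \<open>bij p\<close>, of "{i}"] inj_on_subset[OF bij_is_inj[OF \<open>bij p\<close>]]
      by (simp add: bij_betw_def)
    then have inner: "(\<Sum>j\<in>-{i}. f (p i) (p j)) = (\<Sum>j\<in>-{p i}. f (p i) j)" for i
      by (rule sum.reindex_bij_betw)
    have "(\<Sum>i\<in>UNIV. \<Sum>j\<in>-{i}. f (p i) (p j)) = (\<Sum>i\<in>UNIV. \<Sum>j\<in>-{p i}. f (p i) j)"
      by (rule sum.cong[OF refl inner])
    also have "\<dots> = (\<Sum>i\<in>UNIV. \<Sum>j\<in>-{i}. f i j)"
      by (rule sum.reindex_bij_betw[OF \<open>bij p\<close>, where g = "\<lambda>i. \<Sum>j\<in>-{i}. f i j"])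
    finally show "(\<Sum>i\<in>UNIV. \<Sum>j\<in>-{i}. f (p i) (p j)) = (\<Sum>i\<in>UNIV. \<Sum>j\<in>-{i}. f i j)" .
  qed simp
  also have "\<dots> = fact CARD('n) * (\<Sum>i\<in>UNIV. \<Sum>j\<in>-{i}. f i j)"
    by (simp add: card_permutations)
  finally show ?thesis .
qed

text \<open>
  Split the positions into pairs: a product of numbers in \<open>[-1, 1]\<close> has a defect \<open>1 - \<Prod>\<close> at most the
  sum of the defects of the pairs, and after summation over permutations all pairs have the same
  defect.
\<close>

lemma sum_permutations_even_product:
  fixes c :: "'n::finite \<Rightarrow> real"
  assumes c: "\<And>i. \<bar>c i\<bar> \<le> 1" and "k \<noteq> l" and "even (card J)"
  shows "(\<Sum>p | p permutes UNIV. 1 - (\<Prod>i\<in>J. c (p i)))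
    \<le> real (card J) / 2 * (\<Sum>p | p permutes UNIV. 1 - c (p k) * c (p l))"
proof -
  define m where "m = card J div 2"
  have "card J = 2 * m"
    using assms by (simp add: m_def)
  then have "(\<Sum>p | p permutes UNIV. 1 - (\<Prod>i\<in>J. c (p i)))
    \<le> real m * (\<Sum>p | p permutes UNIV. 1 - c (p k) * c (p l))"
  proof (induction m arbitrary: J)
    case 0
    then show ?case by simp
  next
    case (Suc m)
    from Suc.prems obtain a J' where a: "J = insert a J'" "a \<notin> J'" "card J' = Suc (2 * m)"
      by (auto simp: card_Suc_eq)
    then obtain b K where b: "J' = insert b K" "b \<notin> K" "card K = 2 * m"
      by (auto simp: card_Suc_eq)
    have "a \<noteq> b"
      using a b by auto
    have "(\<Sum>p | p permutes UNIV. 1 - (\<Prod>i\<in>J. c (p i)))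
        \<le> (\<Sum>p | p permutes UNIV. (1 - c (p a) * c (p b)) + (1 - (\<Prod>i\<in>K. c (p i))))"
    proof (rule sum_mono)
      fix p
      \<comment> \<open>\<open>1 - XY \<le> (1 - X) + (1 - Y)\<close> whenever \<open>X\<close> and \<open>Y\<close> are at most 1\<close>
      have "c (p a) * c (p b) \<le> 1"
        using mult_mono[OF c[of "p a"] c[of "p b"]] by (simp add: abs_mult[symmetric])
      moreover have "(\<Prod>i\<in>K. c (p i)) \<le> 1"
        using prod_le_1[of K "\<lambda>i. \<bar>c (p i)\<bar>"] c by (simp add: abs_prod[symmetric])
      ultimately have "0 \<le> (1 - c (p a) * c (p b)) * (1 - (\<Prod>i\<in>K. c (p i)))"
        by simp
      then show "1 - (\<Prod>i\<in>J. c (p i)) \<le> (1 - c (p a) * c (p b)) + (1 - (\<Prod>i\<in>K. c (p i)))"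
        using a b by (simp add: algebra_simps)
    qed
    also have "\<dots> = (\<Sum>p | p permutes UNIV. 1 - c (p a) * c (p b))
        + (\<Sum>p | p permutes UNIV. 1 - (\<Prod>i\<in>K. c (p i)))"
      by (rule sum.distrib)
    also have "(\<Sum>p | p permutes UNIV. 1 - c (p a) * c (p b))
        = (\<Sum>p | p permutes UNIV. 1 - c (p k) * c (p l))"
      using sum_permutations_pair[OF \<open>a \<noteq> b\<close> \<open>k \<noteq> l\<close>, of "\<lambda>x y. 1 - c x * c y"] .
    finally show ?case
      using Suc.IH[OF b(3)] by (simp add: algebra_simps)
  qed
  then show ?thesis
    using \<open>card J = 2 * m\<close> by simp
qed

text \<open>
  A square is the diagonal case of a product of two cosines; \<open>2 c d \<le> c\<^sup>2 + d\<^sup>2\<close> shows that it has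
  the smaller total defect.
\<close>

lemma sum_permutations_square:
  fixes c :: "'n::finite \<Rightarrow> real"
  assumes "k \<noteq> l"
  shows "(\<Sum>p | p permutes UNIV. 1 - (c (p i))\<^sup>2) \<le> (\<Sum>p | p permutes UNIV. 1 - c (p k) * c (p l))"
proof -
  have "(\<Sum>p | p permutes UNIV. 1 - (c (p i))\<^sup>2) = (\<Sum>p | p permutes UNIV. (1 - (c (p k))\<^sup>2)) / 2
      + (\<Sum>p | p permutes UNIV. (1 - (c (p l))\<^sup>2)) / 2"
    using sum_permutations_point[of "\<lambda>x. 1 - (c x)\<^sup>2" i k]
      sum_permutations_point[of "\<lambda>x. 1 - (c x)\<^sup>2" i l] by simp
  also have "\<dots> = (\<Sum>p | p permutes UNIV. (1 - (c (p k))\<^sup>2) / 2 + (1 - (c (p l))\<^sup>2) / 2)"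
    by (simp add: sum.distrib sum_divide_distrib)
  also have "\<dots> \<le> (\<Sum>p | p permutes UNIV. 1 - c (p k) * c (p l))"
  proof (rule sum_mono)
    fix p
    have "0 \<le> (c (p k) - c (p l))\<^sup>2"
      by simp
    then show "(1 - (c (p k))\<^sup>2) / 2 + (1 - (c (p l))\<^sup>2) / 2 \<le> 1 - c (p k) * c (p l)"
      by (simp add: power2_eq_square field_simps)
  qed
  finally show ?thesis .
qed

text \<open>
  The trigonometric core of the lower bound. A coordinate of value \<open>m = k i\<close> contributes
  \<open>m\<^sup>2 / 2\<close> square defects if \<open>m\<close> is even; if \<open>m\<close> is odd, it contributes \<open>(m\<^sup>2 - 1) / 2\<close> of them and
  half a pair. The odd coordinates can be paired because their number is even. Both kinds of defect
  are bounded by the defect of one pair, and the multiplicities add up to half the squared norm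
  of \<open>k\<close>.
\<close>

lemma sum_permutations_prod_cos:
  fixes k :: "'n::finite \<Rightarrow> int" and \<theta> :: "'n \<Rightarrow> real"
  assumes "even (\<Sum>i\<in>UNIV. k i)" and "a \<noteq> b"
  shows "(\<Sum>p | p permutes UNIV. 1 - (\<Prod>i\<in>UNIV. cos (of_int (k i) * \<theta> (p i))))
    \<le> (\<Sum>i\<in>UNIV. of_int (k i) ^ 2) / 2
      * (\<Sum>p | p permutes UNIV. 1 - cos (\<theta> (p a)) * cos (\<theta> (p b)))" (is "?L \<le> _ * ?N")
proof -
  let ?J = "{i. odd (k i)}"
  let ?w = "\<lambda>i. (of_int (k i) ^ 2 - of_bool (odd (k i))) / (2::real)"
  have "even (card ?J)"
    using assms(1) by (simp add: even_sum_iff)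
  have w: "0 \<le> ?w i" for i
  proof -
    have "of_bool (odd (k i)) \<le> (k i)\<^sup>2"
      using zero_less_power2[of "k i"] by (cases "k i = 0") (simp_all del: zero_less_power2 add: int_one_le_iff_zero_less)
    then have "real_of_int (of_bool (odd (k i))) \<le> real_of_int ((k i)\<^sup>2)"
      by (simp only: of_int_le_iff)
    then show ?thesis
      by simp
  qed
  have "?L \<le> (\<Sum>p | p permutes UNIV. (1 - (\<Prod>i\<in>?J. cos (\<theta> (p i)))) 
        + (\<Sum>i\<in>UNIV. ?w i * (1 - (cos (\<theta> (p i)))\<^sup>2)))"
    by (intro sum_mono prod_cos_int_mult_bound)
  also have "\<dots> = (\<Sum>p | p permutes UNIV. 1 - (\<Prod>i\<in>?J. cos (\<theta> (p i))))
        + (\<Sum>i\<in>UNIV. ?w i * (\<Sum>p | p permutes UNIV. 1 - (cos (\<theta> (p i)))\<^sup>2))"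
    unfolding sum.distrib sum_distrib_left by (subst sum.swap) (rule refl)
  also have "\<dots> \<le> real (card ?J) / 2 * ?N + (\<Sum>i\<in>UNIV. ?w i * ?N)"
    using \<open>even (card ?J)\<close> assms(2) w
    by (intro add_mono sum_mono mult_left_mono
        sum_permutations_even_product[where c = "\<lambda>x. cos (\<theta> x)"]
        sum_permutations_square[where c = "\<lambda>x. cos (\<theta> x)"]) auto
  also have "\<dots> = (real (card ?J) / 2 + (\<Sum>i\<in>UNIV. ?w i)) * ?N"
    by (simp add: sum_distrib_right distrib_right)
  also have "real (card ?J) / 2 + (\<Sum>i\<in>UNIV. ?w i) = (\<Sum>i\<in>UNIV. of_int (k i) ^ 2) / 2"
    by (simp add: sum_divide_distrib[symmetric] sum_subtractf of_bool_def sum.If_cases diff_divide_distrib)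
  finally show ?thesis .
qed

section \<open>Signed permutations act on the lattices\<close>

lemma D_latticeI:
  assumes "u = (\<chi> i. real_of_int (k i))" and "even (\<Sum>i\<in>UNIV. k i)"
  shows "u \<in> D_lattice"
  using assms unfolding D_lattice_def by blast

definition signed_perm :: "'n set \<Rightarrow> ('n \<Rightarrow> 'n) \<Rightarrow> real^'n \<Rightarrow> real^'n" where
  "signed_perm X p x = (\<chi> i. if i \<in> X then x $ p i else - x $ p i)"

lemma inner_signed_perm:
  assumes "p permutes (UNIV::'n::finite set)"
  shows "signed_perm X p x \<bullet> v = x \<bullet> signed_perm (p ` X) (inv p) v"
proof -
  have "bij p"
    using assms by (rule permutes_bij)
  then have "x \<bullet> signed_perm (p ` X) (inv p) v
      = (\<Sum>i\<in>UNIV. x $ p i * signed_perm (p ` X) (inv p) v $ p i)"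
    unfolding inner_vec_def inner_real_def
    by (intro sum.reindex_bij_betw[symmetric, where g = "\<lambda>j. x $ j * signed_perm (p ` X) (inv p) v $ j"])
  also have "\<dots> = signed_perm X p x \<bullet> v"
    using \<open>bij p\<close> unfolding inner_vec_def inner_real_def
    by (intro sum.cong) (auto simp: signed_perm_def bij_is_inj inj_image_mem_iff)
  finally show ?thesis ..
qed

lemma norm_signed_perm:
  assumes "p permutes (UNIV::'n::finite set)"
  shows "norm (signed_perm X p x) = norm x"
proof -
  have "(\<Sum>i\<in>UNIV. (signed_perm X p x $ i)\<^sup>2) = (\<Sum>i\<in>UNIV. (x $ p i)\<^sup>2)"
    by (intro sum.cong) (auto simp: signed_perm_def)
  also have "\<dots> = (\<Sum>i\<in>UNIV. (x $ i)\<^sup>2)"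
    by (intro sum.reindex_bij_betw[where g = "\<lambda>i. (x $ i)\<^sup>2"] permutes_bij[OF assms])
  finally show ?thesis
    by (simp add: norm_vec_def L2_set_def)
qed

lemma signed_perm_D_lattice:
  assumes "p permutes (UNIV::'n::finite set)" and "u \<in> D_lattice"
  shows "signed_perm X p u \<in> D_lattice"
proof -
  obtain k where k: "u = (\<chi> i. real_of_int (k i))" "even (\<Sum>i\<in>UNIV. k i)"
    using assms(2) by (auto simp: D_lattice_def)
  define l where "l = (\<lambda>i. if i \<in> X then k (p i) else - k (p i))"
  have "even (\<Sum>i\<in>UNIV. l i - k (p i))"
    by (intro dvd_sum) (auto simp: l_def)
  moreover have "(\<Sum>i\<in>UNIV. k (p i)) = (\<Sum>i\<in>UNIV. k i)"
    by (intro sum.reindex_bij_betw permutes_bij[OF assms(1)])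
  ultimately have "even (\<Sum>i\<in>UNIV. l i)"
    using k(2) by (simp add: sum_subtractf)
  moreover have "signed_perm X p u = (\<chi> i. real_of_int (l i))"
    by (auto simp: signed_perm_def k(1) l_def vec_eq_iff)
  ultimately show ?thesis
    by (rule D_latticeI[rotated])
qed

lemma signed_perm_dual_lattice:
  assumes inv: "\<And>X p u. p permutes UNIV \<Longrightarrow> u \<in> M \<Longrightarrow> signed_perm X p u \<in> M"
    and "p permutes (UNIV::'n::finite set)" "v \<in> dual_lattice M"
  shows "signed_perm X p v \<in> dual_lattice M"
  using assms(3) inv permutes_inv[OF assms(2)]
  by (auto simp: dual_lattice_def inner_signed_perm[OF assms(2)])

lemma mem_voronoi_cell_iff:
  fixes x :: "real^'n"
  shows "x \<in> voronoi_cell L \<longleftrightarrow> (\<forall>v\<in>L. 2 * (x \<bullet> v) \<le> v \<bullet> v)"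
proof -
  have "norm x \<le> norm (x - v) \<longleftrightarrow> 2 * (x \<bullet> v) \<le> v \<bullet> v" for v :: "real^'n"
    by (auto simp: norm_le algebra_simps inner_commute)
  then show ?thesis
    by (simp add: voronoi_cell_def)
qed

lemma signed_perm_voronoi_cell:
  assumes inv: "\<And>X p v. p permutes UNIV \<Longrightarrow> v \<in> L \<Longrightarrow> signed_perm X p v \<in> L"
    and p: "p permutes (UNIV::'n::finite set)" and "x \<in> voronoi_cell L"
  shows "signed_perm X p x \<in> voronoi_cell L"
  unfolding mem_voronoi_cell_iff
proof
  fix v assume "v \<in> L"
  then have "signed_perm (p ` X) (inv p) v \<in> L"
    by (intro inv permutes_inv p)
  then have "2 * (x \<bullet> signed_perm (p ` X) (inv p) v) \<le> (norm (signed_perm (p ` X) (inv p) v))\<^sup>2"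
    using assms(3) by (simp add: mem_voronoi_cell_iff power2_norm_eq_inner)
  then show "2 * (signed_perm X p x \<bullet> v) \<le> v \<bullet> v"
    by (simp add: inner_signed_perm p norm_signed_perm permutes_inv power2_norm_eq_inner)
qed

section \<open>The dual lattice of \<open>D_lattice\<close>\<close>

text \<open>
  Pairing with a vector of even coordinate sum does not see a common half-integral shift \<open>h\<close> of all
  coordinates. Only \<open>h = 0\<close> and \<open>h = 1 / 2\<close> are used: the two cosets of the integer lattice that make
  up the dual lattice.
\<close>

lemma dual_D_latticeI:
  assumes "\<And>j. x $ j - h \<in> \<int>" and "2 * h \<in> \<int>"
  shows "x \<in> dual_lattice (D_lattice :: (real^'n) set)"
  unfolding dual_lattice_def
proof safe
  fix u :: "real^'n" assume "u \<in> D_lattice"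
  then obtain k where k: "u = (\<chi> i. real_of_int (k i))" "even (\<Sum>i\<in>UNIV. k i)"
    by (auto simp: D_lattice_def)
  then obtain l where l: "(\<Sum>i\<in>UNIV. k i) = 2 * l"
    by (auto elim: evenE)
  have "x \<bullet> u = (\<Sum>i\<in>UNIV. (x $ i - h) * of_int (k i)) + h * of_int (\<Sum>i\<in>UNIV. k i)"
    by (simp add: k inner_vec_def sum_distrib_left sum.distrib[symmetric] algebra_simps)
  also have "\<dots> = (\<Sum>i\<in>UNIV. (x $ i - h) * of_int (k i)) + (2 * h) * of_int l"
    by (simp add: l)
  also have "\<dots> \<in> \<int>"
    using Ints_mult[OF assms(2), of "of_int l"] assms(1)
    by (intro Ints_add Ints_sum Ints_mult[of "x $ i - h" for i]) auto
  finally show "x \<bullet> u \<in> \<int>" .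
qed

lemma dual_D_lattice_half_integral:
  assumes "v \<in> dual_lattice (D_lattice :: (real^'n) set)"
  shows "2 * v $ i \<in> \<int>"
proof -
  have "axis i 2 = (\<chi> m. real_of_int (if m = i then 2 else 0))"
    by (auto simp: vec_eq_iff axis_def)
  moreover have "even (\<Sum>m\<in>UNIV. if m = i then 2 else 0 :: int)"
    by simp
  ultimately have "axis i 2 \<in> (D_lattice :: (real^'n) set)"
    by (rule D_latticeI)
  then have "v \<bullet> axis i 2 \<in> \<int>"
    using assms by (auto simp: dual_lattice_def)
  then show ?thesis
    by (simp add: inner_axis mult.commute)
qed

lemma axis_in_dual_D_lattice:
  assumes "a \<in> \<int>"
  shows "axis i a \<in> dual_lattice (D_lattice :: (real^'n) set)"
  by (rule dual_D_latticeI[where h = 0]) (use assms in \<open>auto simp: axis_def\<close>)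

text \<open>
  Testing against \<open>axis i 1\<close> makes the coordinates of a bidual vector integral, and testing against the
  vector with all coordinates \<open>1 / 2\<close> makes their sum even.
\<close>

lemma dual_dual_D_lattice: "dual_lattice (dual_lattice D_lattice) = (D_lattice :: (real^'n) set)"
proof
  show "D_lattice \<subseteq> dual_lattice (dual_lattice (D_lattice :: (real^'n) set))"
    by (auto simp: dual_lattice_def inner_commute)
  show "dual_lattice (dual_lattice D_lattice) \<subseteq> (D_lattice :: (real^'n) set)"
  proof
    fix u :: "real^'n" assume u: "u \<in> dual_lattice (dual_lattice D_lattice)"
    have "u $ i \<in> \<int>" for i
    proof -
      have "axis i 1 \<in> dual_lattice (D_lattice :: (real^'n) set)"
        by (rule axis_in_dual_D_lattice) simp
      then have "u \<bullet> axis i 1 \<in> \<int>"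
        using u unfolding dual_lattice_def by blast
      then show ?thesis
        by (simp add: inner_axis)
    qed
    then have "\<forall>i. \<exists>k. u $ i = of_int k"
      by (auto elim!: Ints_cases)
    then obtain k where k: "\<And>i. u $ i = of_int (k i)"
      by metis
    have "(\<chi> i. 1 / 2) \<in> dual_lattice (D_lattice :: (real^'n) set)"
      by (rule dual_D_latticeI[where h = "1 / 2"]) auto
    then have "u \<bullet> (\<chi> i. 1 / 2) \<in> \<int>"
      using u unfolding dual_lattice_def by blast
    moreover have "u \<bullet> (\<chi> i. 1 / 2) = of_int (\<Sum>i\<in>UNIV. k i) / 2"
      by (simp add: inner_vec_def k sum_divide_distrib)
    ultimately have "even (\<Sum>i\<in>UNIV. k i)"
      by (metis of_int_div_of_int_in_Ints_iff of_int_numeral zero_neq_numeral)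
    moreover have "u = (\<chi> i. real_of_int (k i))"
      by (simp add: vec_eq_iff k)
    ultimately show "u \<in> D_lattice"
      by (rule D_latticeI[rotated])
  qed
qed

section \<open>Sums over the roots\<close>

definition root_index :: "(real \<times> real \<times> 'n \<times> 'n) set" where
  "root_index = {(a, b, i, j). a \<in> {1, -1} \<and> b \<in> {1, -1} \<and> i \<noteq> j}"

definition root_of :: "real \<times> real \<times> 'n \<times> 'n \<Rightarrow> real^'n" where
  "root_of = (\<lambda>(a, b, i, j). axis i a + axis j b)"

lemma D_roots_eq: "D_roots = root_of ` root_index"
proof (intro set_eqI iffI)
  fix u :: "real^'n" assume "u \<in> D_roots"
  then obtain s t i j where u: "u = s *\<^sub>R (axis i 1 + t *\<^sub>R axis j 1)"
    "s \<in> {1, -1}" "t \<in> {1, -1}" "i \<noteq> j"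
    unfolding D_roots_def by blast
  then have "u = root_of (s, s * t, i, j)" "(s, s * t, i, j) \<in> root_index"
    by (auto simp: root_of_def root_index_def vec_eq_iff axis_def)
  then show "u \<in> root_of ` root_index"
    by blast
next
  fix u :: "real^'n" assume "u \<in> root_of ` root_index"
  then obtain a b i j where u: "u = axis i a + axis j b" "a \<in> {1, -1}" "b \<in> {1, -1}" "i \<noteq> j"
    by (auto simp: root_of_def root_index_def)
  then have "u = a *\<^sub>R (axis i 1 + (a * b) *\<^sub>R axis j 1)" "a * b \<in> {1, -1}"
    by (auto simp: vec_eq_iff axis_def)
  with u show "u \<in> D_roots"
    unfolding D_roots_def by blast
qed

lemma finite_root_index: "finite (root_index :: (real \<times> real \<times> 'n::finite \<times> 'n) set)"
  by (rule finite_subset[of _ "{1, -1} \<times> {1, -1} \<times> UNIV"]) (auto simp: root_index_def)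

lemma finite_D_roots: "finite (D_roots :: (real^'n) set)"
  by (simp add: D_roots_eq finite_root_index)

lemma root_of_eq_iff:
  assumes "(a, b, i, j) \<in> root_index" "(a', b', i', j') \<in> root_index"
  shows "root_of (a', b', i', j') = root_of (a, b, i, j)
    \<longleftrightarrow> (a', b', i', j') \<in> {(a, b, i, j), (b, a, j, i)}"
proof
  assume "root_of (a', b', i', j') = root_of (a, b, i, j)"
  then have "(axis i' a' + axis j' b') $ m = (axis i a + axis j b) $ m" for m
    by (simp add: root_of_def)
  from this[of i] this[of j] this[of i'] this[of j']
  show "(a', b', i', j') \<in> {(a, b, i, j), (b, a, j, i)}"
    using assms by (auto simp: root_index_def axis_def split: if_splits)
qed (auto simp: root_of_def)

text \<open>
  Each root is \<open>axis i a + axis j b\<close> for exactly two quadruples \<open>(a, b, i, j)\<close>, which differ by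
  exchanging \<open>(a, i)\<close> and \<open>(b, j)\<close>.
\<close>

lemma sum_D_roots:
  fixes f :: "real^'n \<Rightarrow> real"
  shows "2 * (\<Sum>u\<in>D_roots. f u)
    = (\<Sum>i\<in>UNIV. \<Sum>j\<in>-{i}. \<Sum>a\<in>{1, -1}. \<Sum>b\<in>{1, -1}. f (axis i a + axis j b))"
proof -
  have sigma: "(\<Sum>(i, j, a, b)\<in>(SIGMA i:UNIV. SIGMA j:-{i}. S \<times> S). f (axis i a + axis j b))
      = (\<Sum>i\<in>UNIV. \<Sum>j\<in>-{i}. \<Sum>a\<in>S. \<Sum>b\<in>S. f (axis i a + axis j b))" if "finite S" for S
    using that by (simp add: sum.Sigma)
  have "card {q \<in> root_index. root_of q = u} = 2" if u: "u \<in> D_roots" for u :: "real^'n"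
  proof -
    obtain a b i j where q: "u = root_of (a, b, i, j)" "(a, b, i, j) \<in> root_index"
      using u unfolding D_roots_eq by fast
    have "{q \<in> root_index. root_of q = u} = {(a, b, i, j), (b, a, j, i)}"
      using root_of_eq_iff[OF q(2)] q by (auto simp: root_index_def root_of_def)
    then show ?thesis
      using q(2) by (auto simp: root_index_def)
  qed
  then have "(\<Sum>q\<in>root_index. f (root_of q)) = (\<Sum>u\<in>D_roots. 2 * f u)"
    by (subst sum_fun_comp[of root_index D_roots root_of f])
      (auto simp: finite_root_index finite_D_roots D_roots_eq intro!: sum.cong)
  also have "(\<Sum>q\<in>root_index. f (root_of q))
     = (\<Sum>(i, j, a, b)\<in>(SIGMA i:UNIV. SIGMA j:-{i}. {1, -1} \<times> {1, -1}). f (axis i a + axis j b))"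
    by (rule sum.reindex_bij_witness[of _ "\<lambda>(i, j, a, b). (a, b, i, j)" "\<lambda>(a, b, i, j). (i, j, a, b)"])
      (auto simp: root_index_def root_of_def)
  also have "\<dots> = (\<Sum>i\<in>UNIV. \<Sum>j\<in>-{i}. \<Sum>a\<in>{1, -1}. \<Sum>b\<in>{1, -1}. f (axis i a + axis j b))"
    using sigma[of "{1, -1}"] by simp
  finally show ?thesis
    by (simp add: sum_distrib_left)
qed

lemma uminus_D_roots: "u \<in> D_roots \<Longrightarrow> - u \<in> D_roots"
proof -
  assume "u \<in> D_roots"
  then obtain s t i j where "u = s *\<^sub>R (axis i 1 + t *\<^sub>R axis j 1)"
    "s \<in> {1, -1}" "t \<in> {1, -1}" "i \<noteq> j"
    unfolding D_roots_def by blast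
  then have "- u = (- s) *\<^sub>R (axis i 1 + t *\<^sub>R axis j 1)" "- s \<in> {1, -1}"
    by auto
  with \<open>t \<in> _\<close> \<open>i \<noteq> j\<close> show "- u \<in> D_roots"
    unfolding D_roots_def by blast
qed

lemma D_roots_subset: "D_roots \<subseteq> (D_lattice :: (real^'n) set)"
proof
  fix u :: "real^'n" assume "u \<in> D_roots"
  then obtain a b i j where u: "u = axis i a + axis j b" "a \<in> {1, -1}" "b \<in> {1, -1}" "i \<noteq> j"
    by (auto simp: D_roots_eq root_of_def root_index_def)
  define k :: "'n \<Rightarrow> int" where "k = (\<lambda>m. (if m = i then \<lfloor>a\<rfloor> else 0) + (if m = j then \<lfloor>b\<rfloor> else 0))"
  have "u = (\<chi> m. real_of_int (k m))"
    using u by (auto simp: vec_eq_iff axis_def k_def)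
  moreover have "\<lfloor>a\<rfloor> \<in> {1, -1}" "\<lfloor>b\<rfloor> \<in> {1, -1}"
    using u(2,3) by (auto simp: floor_eq_iff)
  then have "even (\<Sum>m\<in>UNIV. k m)"
    by (auto simp: k_def sum.distrib)
  ultimately show "u \<in> D_lattice"
    by (rule D_latticeI)
qed

section \<open>The root energy\<close>

definition root_energy :: "real^'n \<Rightarrow> real" where
  "root_energy x = (\<Sum>u\<in>D_roots. 1 - cos (2 * pi * (u \<bullet> x)))"

lemma inner_root: "(axis i a + axis j b) \<bullet> x = a * x $ i + b * x $ j" for x :: "real^'n"
  by (simp add: inner_add_left inner_axis')

text \<open>
  For fixed \<open>i\<close> and \<open>j\<close> the four sign choices average \<open>cos (\<plusminus> s \<plusminus> t)\<close> to \<open>cos s * cos t\<close>.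
\<close>

lemma root_energy_eq:
  "root_energy x = 2 * (\<Sum>i\<in>UNIV. \<Sum>j\<in>-{i}. 1 - cos (2 * pi * x $ i) * cos (2 * pi * x $ j))"
proof -
  have "(\<Sum>a\<in>{1, -1}. \<Sum>b\<in>{1, -1}. 1 - cos (2 * pi * ((axis i a + axis j b) \<bullet> x)))
      = 4 * (1 - cos (2 * pi * x $ i) * cos (2 * pi * x $ j))" for i j
    by (simp add: inner_root distrib_left right_diff_distrib cos_add cos_diff)
  then have "2 * root_energy x
      = (\<Sum>i\<in>UNIV. \<Sum>j\<in>-{i}. 4 * (1 - cos (2 * pi * x $ i) * cos (2 * pi * x $ j)))"
    unfolding root_energy_def sum_D_roots by (simp only:)
  then show ?thesis
    by (simp only: sum_distrib_left[symmetric])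
qed

lemma ex_other_index:
  assumes "2 \<le> CARD('n::finite)"
  obtains j where "j \<noteq> (i::'n)"
proof -
  have "(UNIV :: 'n set) \<noteq> {i}"
  proof
    assume "(UNIV :: 'n set) = {i}"
    then have "CARD('n) = card {i}"
      by (rule arg_cong)
    with assms show False
      by simp
  qed
  then show ?thesis
    using that by auto
qed

lemma root_energy_nonneg: "0 \<le> root_energy x"
  unfolding root_energy_def by (intro sum_nonneg) simp

text \<open>
  If the energy vanishes, then the product of any two of the numbers \<open>cos (2 pi x_i)\<close> is 1. Hence they
  are all 1 or all -1, and the coordinates of \<open>x\<close> are all integers or all half-odd integers.
\<close>

lemma root_energy_eq_0_imp:
  fixes x :: "real^'n"
  assumes "2 \<le> CARD('n)" and "root_energy x = 0"
  shows "x \<in> dual_lattice D_lattice"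
proof -
  let ?c = "\<lambda>i. cos (2 * pi * x $ i)"
  have le: "?c i * ?c j \<le> 1" for i j
    using abs_le_iff[of "?c i * ?c j" 1] mult_le_one[of "\<bar>?c i\<bar>" "\<bar>?c j\<bar>"] by (simp add: abs_mult)
  have "(\<Sum>i\<in>UNIV. \<Sum>j\<in>-{i}. 1 - ?c i * ?c j) = 0"
    using assms(2) by (simp add: root_energy_eq)
  then have "\<forall>i\<in>UNIV. (\<Sum>j\<in>-{i}. 1 - ?c i * ?c j) = 0"
    by (subst (asm) sum_nonneg_eq_0_iff) (auto intro!: sum_nonneg simp: le)
  then have one: "?c i * ?c j = 1" if "i \<noteq> j" for i j
    using that by (subst (asm) sum_nonneg_eq_0_iff) (auto simp: le)
  have same: "?c j = ?c i" for i j
  proof (cases "i = j")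
    case False
    have "?c i * ?c j = 1" "\<bar>?c i\<bar> \<le> 1" "\<bar>?c j\<bar> \<le> 1"
      using one[OF False] by auto
    then show ?thesis
      by (smt (verit) mult_less_cancel_left1 mult_less_cancel_left2 mult_minus_left mult_minus_right mult_le_cancel_left1)
  qed simp
  obtain i :: 'n where True
    by simp
  obtain j where "j \<noteq> i"
    using ex_other_index[OF assms(1)] .
  then have "?c i * ?c i = 1"
    using one[of i j] same[of j i] by simp
  then have "(?c i - 1) * (?c i + 1) = 0"
    by (simp add: algebra_simps)
  then consider "?c i = 1" | "?c i = -1"
    by (auto simp: add_eq_0_iff)
  then show ?thesis
  proof cases
    case 1
    have "x $ j - 0 \<in> \<int>" for j
    proof -
      obtain m :: int where "2 * pi * x $ j = of_int m * 2 * pi"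
        using 1 same cos_one_2pi_int by metis
      then have "x $ j = of_int m"
        by simp
      then show ?thesis
        by simp
    qed
    then show ?thesis
      by (rule dual_D_latticeI) simp
  next
    case 2
    have "x $ j - 1 / 2 \<in> \<int>" for j
    proof -
      obtain m :: int where "2 * pi * x $ j = (2 * of_int m + 1) * pi"
        using 2 same cos_eq_minus1 by metis
      then have "pi * (2 * x $ j) = pi * (2 * of_int m + 1)"
        by (simp only: ac_simps)
      then have "x $ j - 1 / 2 = of_int m"
        by simp
      then show ?thesis
        by simp
    qed
    then show ?thesis
      by (rule dual_D_latticeI) simp
  qed
qed

text \<open>
  A lattice vector in the Voronoi cell is at least as close to 0 as to itself, so it is 0. Thus the
  denominators in the definition of \<open>\<alpha>\<close> do not vanish.
\<close>

lemma root_energy_pos: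
  fixes x :: "real^'n"
  assumes "2 \<le> CARD('n)" and "x \<in> voronoi_cell (dual_lattice D_lattice)" and "x \<noteq> 0"
  shows "0 < root_energy x"
proof (rule ccontr)
  assume "\<not> ?thesis"
  then have "root_energy x = 0"
    using root_energy_nonneg[of x] by simp
  then have "x \<in> dual_lattice D_lattice"
    by (rule root_energy_eq_0_imp[OF assms(1)])
  then have "norm x \<le> norm (x - x)"
    using assms(2) unfolding voronoi_cell_def by blast
  then show False
    using assms(3) by simp
qed

lemma sum_D_roots_inner_square:
  fixes x :: "real^'n"
  shows "(\<Sum>u\<in>D_roots. (u \<bullet> x)\<^sup>2) = 4 * (real CARD('n) - 1) * (norm x)\<^sup>2"
proof -
  have "(\<Sum>a\<in>{1, -1}. \<Sum>b\<in>{1, -1}. ((axis i a + axis j b) \<bullet> x)\<^sup>2) = 4 * (x $ i)\<^sup>2 + 4 * (x $ j)\<^sup>2" for i j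
    unfolding inner_root by (simp add: power2_eq_square algebra_simps)
  then have "2 * (\<Sum>u\<in>D_roots. (u \<bullet> x)\<^sup>2) = (\<Sum>i\<in>UNIV. \<Sum>j\<in>-{i}. 4 * (x $ i)\<^sup>2 + 4 * (x $ j)\<^sup>2)"
    unfolding sum_D_roots by (simp only:)
  also have "\<dots> = (\<Sum>i\<in>UNIV. (real CARD('n) - 1) * (4 * (x $ i)\<^sup>2) + ((\<Sum>j\<in>UNIV. 4 * (x $ j)\<^sup>2) - 4 * (x $ i)\<^sup>2))"
    by (intro sum.cong)
      (simp_all add: sum.distrib Compl_eq_Diff_UNIV sum_diff1 card_Diff_singleton of_nat_diff)
  also have "\<dots> = 8 * (real CARD('n) - 1) * (\<Sum>i\<in>UNIV. (x $ i)\<^sup>2)"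
    by (simp add: sum.distrib sum_subtractf sum_distrib_left[symmetric] algebra_simps)
  also have "(\<Sum>i\<in>UNIV. (x $ i)\<^sup>2) = (norm x)\<^sup>2"
    unfolding power2_norm_eq_inner inner_vec_def by (simp add: power2_eq_square)
  finally show ?thesis
    by (simp add: algebra_simps)
qed

text \<open>
  Polarization of the quadratic form \<open>\<Sum>u\<in>D_roots. (u \<bullet> x)\<^sup>2\<close>, which is a multiple of the squared
  norm.
\<close>

lemma sum_D_roots_outer_square:
  "(\<Sum>u\<in>D_roots. outer_square u) = (4 * (real CARD('n) - 1)) *\<^sub>R (mat 1 :: real^'n^'n)"
proof -
  have "(\<Sum>u\<in>D_roots. u $ k * u $ l) = 4 * (real CARD('n) - 1) * of_bool (k = l)" for k l :: 'n
  proof -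
    let ?x = "axis k 1 :: real^'n" and ?y = "axis l 1 :: real^'n"
    have "4 * (u $ k * u $ l) = (u \<bullet> (?x + ?y))\<^sup>2 - (u \<bullet> (?x - ?y))\<^sup>2" for u :: "real^'n"
      by (simp add: inner_axis inner_add_right inner_diff_right power2_eq_square algebra_simps)
    then have "4 * (\<Sum>u\<in>D_roots. u $ k * u $ l)
        = (\<Sum>u\<in>D_roots. (u \<bullet> (?x + ?y))\<^sup>2) - (\<Sum>u\<in>D_roots. (u \<bullet> (?x - ?y))\<^sup>2)"
      by (simp add: sum_distrib_left sum_subtractf)
    also have "\<dots> = 4 * (real CARD('n) - 1) * ((norm (?x + ?y))\<^sup>2 - (norm (?x - ?y))\<^sup>2)"
      by (simp only: sum_D_roots_inner_square right_diff_distrib)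
    also have "(norm (?x + ?y))\<^sup>2 - (norm (?x - ?y))\<^sup>2 = 4 * of_bool (k = l)"
      by (simp add: power2_norm_eq_inner inner_add_left inner_add_right inner_diff_left
          inner_diff_right inner_axis_axis)
    finally show ?thesis
      by simp
  qed
  then show ?thesis
    by (simp add: vec_eq_iff outer_square_def mat_def)
qed

section \<open>The lower bound for every feasible pair\<close>

text \<open>
  Among all vectors of \<open>D_lattice\<close>, the roots make the average of \<open>1 - cos (2 pi (u \<bullet> y))\<close> over the orbit
  of \<open>x\<close> largest in proportion to the squared norm of \<open>u\<close>: for a root, equality holds. The average over
  the signs produces a product of cosines, to which the permutation estimate applies. The factor
  \<open>fact CARD('n) * 2 ^ CARD('n)\<close> is the order of the group of signed permutations.
\<close>

lemma sum_signed_perm_one_minus_cos_le: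
  fixes x u :: "real^'n"
  assumes n: "2 \<le> CARD('n)" and "u \<in> D_lattice"
  shows "(\<Sum>p | p permutes UNIV. \<Sum>X\<in>UNIV. 1 - cos (2 * pi * (u \<bullet> signed_perm X p x)))
    \<le> fact CARD('n) * 2 ^ CARD('n)
      * (root_energy x / (4 * real CARD('n) * (real CARD('n) - 1)) * (norm u)\<^sup>2)"
proof -
  obtain k where k: "u = (\<chi> i. real_of_int (k i))" "even (\<Sum>i\<in>UNIV. k i)"
    using assms(2) by (auto simp: D_lattice_def)
  obtain a b :: 'n where ab: "a \<noteq> b"
    by (rule ex_other_index[OF n, of undefined])
  define \<theta> where "\<theta> = (\<lambda>i. 2 * pi * x $ i)"
  define N where "N = (\<Sum>p | p permutes UNIV. 1 - cos (\<theta> (p a)) * cos (\<theta> (p b)))"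
  have card_sets: "card (UNIV :: 'n set set) = 2 ^ CARD('n)"
    using card_Pow[of "UNIV :: 'n set"] by simp
  have "(\<Sum>X\<in>UNIV. 1 - cos (2 * pi * (u \<bullet> signed_perm X p x)))
      = 2 ^ CARD('n) * (1 - (\<Prod>i\<in>UNIV. cos (of_int (k i) * \<theta> (p i))))" for p
  proof -
    have "2 * pi * (u \<bullet> signed_perm X p x)
        = (\<Sum>i\<in>UNIV. if i \<in> X then of_int (k i) * \<theta> (p i) else - (of_int (k i) * \<theta> (p i)))" for X
      unfolding inner_vec_def sum_distrib_left
      by (intro sum.cong) (auto simp: k signed_perm_def \<theta>_def)
    then show ?thesis
      by (simp add: sum_subtractf sum_cos_all_signs card_sets right_diff_distrib)
  qed
  then have "(\<Sum>p | p permutes UNIV. \<Sum>X\<in>UNIV. 1 - cos (2 * pi * (u \<bullet> signed_perm X p x)))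
      = 2 ^ CARD('n) * (\<Sum>p | p permutes UNIV. 1 - (\<Prod>i\<in>UNIV. cos (of_int (k i) * \<theta> (p i))))"
    by (simp add: sum_distrib_left)
  also have "\<dots> \<le> 2 ^ CARD('n) * ((\<Sum>i\<in>UNIV. of_int (k i) ^ 2) / 2 * N)"
    unfolding N_def by (intro mult_left_mono sum_permutations_prod_cos k ab) simp
  also have "(\<Sum>i\<in>UNIV. of_int (k i) ^ 2) = (norm u)\<^sup>2"
    unfolding power2_norm_eq_inner inner_vec_def by (simp add: k power2_eq_square)
  also have "N = fact CARD('n) * (root_energy x / 2) / (real CARD('n) * (real CARD('n) - 1))"
  proof -
    have "real CARD('n) * (real CARD('n) - 1) * N = fact CARD('n) * (root_energy x / 2)"
      unfolding N_def using sum_permutations_off_diagonal[OF ab, of "\<lambda>i j. 1 - cos (\<theta> i) * cos (\<theta> j)"]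
      by (simp add: root_energy_eq \<theta>_def)
    moreover have "real CARD('n) * (real CARD('n) - 1) \<noteq> 0"
      using n by auto
    ultimately show ?thesis
      by (simp add: nonzero_eq_divide_eq mult.commute)
  qed
  finally show ?thesis
    by (simp add: mult_ac)
qed

lemma has_sum_finite_sum:
  fixes f :: "'i \<Rightarrow> 'a \<Rightarrow> real"
  assumes "\<And>i. i \<in> I \<Longrightarrow> (f i has_sum s i) A"
  shows "((\<lambda>x. \<Sum>i\<in>I. f i x) has_sum (\<Sum>i\<in>I. s i)) A"
  using assms by (induction I rule: infinite_finite_induct) (auto intro: has_sum_add has_sum_0)

text \<open>
  Take the trace of the matrix constraint; the trace of \<open>outer_square u\<close> is the squared norm of \<open>u\<close>.
\<close>

lemma has_sum_second_moment:
  fixes w :: "real^'n \<Rightarrow> real"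
  assumes "(\<lambda>u. w u *\<^sub>R outer_square u) summable_on A"
    and psd: "C *\<^sub>R mat 1 - c *\<^sub>R (\<Sum>\<^sub>\<infinity>u\<in>A. w u *\<^sub>R outer_square u) \<in> psd_cone"
  shows "\<exists>M. ((\<lambda>u. w u * (norm u)\<^sup>2) has_sum M) A \<and> c * M \<le> real CARD('n) * C"
proof -
  define S where "S = (\<Sum>\<^sub>\<infinity>u\<in>A. w u *\<^sub>R outer_square u)"
  have "bounded_linear (\<lambda>B :: real^'n^'n. \<Sum>i\<in>UNIV. B $ i $ i)"
    by (intro bounded_linear_sum bounded_linear_compose[OF bounded_linear_vec_nth bounded_linear_vec_nth])
  from has_sum_bounded_linear[OF this has_sum_infsum[OF assms(1)]]
  have "((\<lambda>u. w u * (norm u)\<^sup>2) has_sum (\<Sum>i\<in>UNIV. S $ i $ i)) A"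
    unfolding S_def power2_norm_eq_inner inner_vec_def by (simp add: outer_square_def sum_distrib_left)
  moreover have "0 \<le> C - c * S $ i $ i" for i
  proof -
    have "0 \<le> axis i 1 \<bullet> ((C *\<^sub>R mat 1 - c *\<^sub>R S) *v axis i 1)"
      using psd unfolding psd_cone_def S_def by blast
    then show ?thesis
      by (simp add: matrix_vector_mult_basis column_def inner_axis' mat_def)
  qed
  then have "0 \<le> (\<Sum>i\<in>UNIV. C - c * S $ i $ i)"
    by (intro sum_nonneg)
  then have "c * (\<Sum>i\<in>UNIV. S $ i $ i) \<le> real CARD('n) * C"
    by (simp add: sum_subtractf sum_distrib_left)
  ultimately show ?thesis
    by blast
qed

text \<open>
  The Voronoi cell is invariant under signed permutations, so the distance constraint holds on the
  whole orbit of \<open>x\<close>. Summing it over the group leaves a bound in which the weights occur only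
  through their second moment, and the matrix constraint controls that moment by \<open>C\<close>.
\<close>

lemma feasible_lower_bound:
  fixes x :: "real^'n" and z :: "real^'n \<Rightarrow> complex"
  assumes n: "2 \<le> CARD('n)"
    and feas: "feasible (dual_lattice D_lattice) C z"
    and x: "x \<in> voronoi_cell (dual_lattice D_lattice)"
  shows "8 * pi\<^sup>2 * (real CARD('n) - 1) * (norm x)\<^sup>2 \<le> C * root_energy x"
proof -
  let ?n = "real CARD('n)" and ?G = "fact CARD('n) * 2 ^ CARD('n) :: real"
  let ?D = "D_lattice :: (real^'n) set"
  define w where "w = (\<lambda>u. Re (z u))"
  define F where "F = (\<lambda>y :: real^'n. \<Sum>\<^sub>\<infinity>u\<in>?D. w u * (1 - cos (2 * pi * (u \<bullet> y))))"
  define K where "K = root_energy x / (4 * ?n * (?n - 1))"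
  have w: "0 \<le> w u" if "u \<in> ?D" for u
    using feas that unfolding feasible_def dual_dual_D_lattice w_def
    by (auto simp: complex_nonneg_Reals_iff)
  have abs_z: "(\<lambda>u. 2 * norm (z u)) summable_on ?D"
    using feas unfolding feasible_def dual_dual_D_lattice by (intro summable_on_cmult_right) auto
  have F: "((\<lambda>u. w u * (1 - cos (2 * pi * (u \<bullet> y)))) has_sum F y) ?D" for y
  proof -
    have "norm (w u * (1 - cos (2 * pi * (u \<bullet> y)))) \<le> 2 * norm (z u)" for u
    proof -
      have "\<bar>w u\<bar> * \<bar>1 - cos (2 * pi * (u \<bullet> y))\<bar> \<le> norm (z u) * 2"
        unfolding w_def using cos_ge_minus_one[of "2 * pi * (u \<bullet> y)"]
        by (intro mult_mono abs_Re_le_cmod) auto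
      then show ?thesis
        by (simp add: abs_mult)
    qed
    then have "(\<lambda>u. w u * (1 - cos (2 * pi * (u \<bullet> y)))) summable_on ?D"
      by (rule abs_summable_summable[OF Infinite_Sum.abs_summable_on_comparison_test'[OF abs_z]])
    then show ?thesis
      unfolding F_def by (rule has_sum_infsum)
  qed
  have "(\<lambda>u. w u *\<^sub>R outer_square u) summable_on ?D"
    "C *\<^sub>R mat 1 - (4 * pi\<^sup>2) *\<^sub>R (\<Sum>\<^sub>\<infinity>u\<in>?D. w u *\<^sub>R outer_square u) \<in> psd_cone"
    using feas unfolding feasible_def dual_dual_D_lattice w_def by auto
  then obtain M where M: "((\<lambda>u. w u * (norm u)\<^sup>2) has_sum M) ?D" "4 * pi\<^sup>2 * M \<le> ?n * C"
    using has_sum_second_moment by blast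
  have "(norm x)\<^sup>2 \<le> 2 * F (signed_perm X p x)" if "p permutes UNIV" for X p
  proof -
    have "signed_perm X p x \<in> voronoi_cell (dual_lattice D_lattice)"
      using that x by (intro signed_perm_voronoi_cell signed_perm_dual_lattice signed_perm_D_lattice)
    then have "(norm (signed_perm X p x))\<^sup>2 \<le> 2 * F (signed_perm X p x)"
      using feas unfolding feasible_def dual_dual_D_lattice F_def w_def by blast
    then show ?thesis
      by (simp add: norm_signed_perm that)
  qed
  then have "(\<Sum>p | p permutes (UNIV::'n set). \<Sum>X\<in>(UNIV::'n set set). (norm x)\<^sup>2)
      \<le> (\<Sum>p | p permutes UNIV. \<Sum>X\<in>UNIV. 2 * F (signed_perm X p x))"
    by (intro sum_mono) auto
  moreover have "(\<Sum>p | p permutes (UNIV::'n set). \<Sum>X\<in>(UNIV::'n set set). (norm x)\<^sup>2) = ?G * (norm x)\<^sup>2"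
    using card_Pow[of "UNIV :: 'n set"] by (simp add: card_permutations)
  ultimately have "?G * (norm x)\<^sup>2 \<le> 2 * (\<Sum>p | p permutes UNIV. \<Sum>X\<in>UNIV. F (signed_perm X p x))"
    by (simp only: sum_distrib_left)
  also have "(\<Sum>p | p permutes UNIV. \<Sum>X\<in>UNIV. F (signed_perm X p x)) \<le> ?G * K * M"
  proof (rule has_sum_mono)
    show "((\<lambda>u. \<Sum>p | p permutes UNIV. \<Sum>X\<in>UNIV. w u * (1 - cos (2 * pi * (u \<bullet> signed_perm X p x))))
        has_sum (\<Sum>p | p permutes UNIV. \<Sum>X\<in>UNIV. F (signed_perm X p x))) ?D"
      by (intro has_sum_finite_sum F)
    show "((\<lambda>u. ?G * K * (w u * (norm u)\<^sup>2)) has_sum ?G * K * M) ?D"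
      by (intro has_sum_cmult_right M)
    fix u assume u: "u \<in> ?D"
    have "w u * (\<Sum>p | p permutes UNIV. \<Sum>X\<in>UNIV. 1 - cos (2 * pi * (u \<bullet> signed_perm X p x)))
        \<le> w u * (?G * (K * (norm u)\<^sup>2))"
      unfolding K_def by (intro mult_left_mono sum_signed_perm_one_minus_cos_le n u w)
    then show "(\<Sum>p | p permutes UNIV. \<Sum>X\<in>UNIV. w u * (1 - cos (2 * pi * (u \<bullet> signed_perm X p x))))
        \<le> ?G * K * (w u * (norm u)\<^sup>2)"
      by (simp add: sum_distrib_left mult_ac)
  qed
  finally have "?G * (norm x)\<^sup>2 \<le> ?G * (2 * K * M)"
    by (simp add: mult_ac)
  then have "(norm x)\<^sup>2 \<le> 2 * K * M"
    by (simp add: mult_le_cancel_left_pos)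
  moreover have "0 < ?n" "0 < ?n - 1"
    using n by auto
  ultimately have "2 * ?n * (?n - 1) * (norm x)\<^sup>2 \<le> root_energy x * M"
    by (simp add: K_def field_simps)
  then have "4 * pi\<^sup>2 * (2 * ?n * (?n - 1) * (norm x)\<^sup>2) \<le> 4 * pi\<^sup>2 * (root_energy x * M)"
    by (intro mult_left_mono) auto
  also have "\<dots> = root_energy x * (4 * pi\<^sup>2 * M)"
    by simp
  also have "\<dots> \<le> root_energy x * (?n * C)"
    by (intro mult_left_mono M root_energy_nonneg)
  finally have "?n * (8 * pi\<^sup>2 * (?n - 1) * (norm x)\<^sup>2) \<le> ?n * (C * root_energy x)"
    by (simp add: algebra_simps)
  then show ?thesis
    using \<open>0 < ?n\<close> by (simp only: mult_le_cancel_left_pos)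
qed

section \<open>Feasibility of the root weights\<close>

text \<open>
  The constant is chosen so that the matrix in the semidefinite constraint is 0, because the roots
  form a tight frame. The distance constraint is the bound on the ratios.
\<close>

lemma root_weights_feasible:
  fixes z :: "real^'n \<Rightarrow> complex"
  assumes z: "z = (\<lambda>u. if u \<in> D_roots then complex_of_real \<alpha> else 0)"
    and \<alpha>: "0 \<le> \<alpha>"
    and bound: "\<And>x :: real^'n. x \<in> voronoi_cell (dual_lattice D_lattice) \<Longrightarrow> (norm x)\<^sup>2 \<le> 2 * \<alpha> * root_energy x"
  shows "feasible (dual_lattice D_lattice) (16 * pi\<^sup>2 * (real CARD('n) - 1) * \<alpha>) z"
proof -
  have sums: "((\<lambda>u. Re (z u) *\<^sub>R g u) has_sum \<alpha> *\<^sub>R (\<Sum>u\<in>D_roots. g u)) D_lattice"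
    for g :: "real^'n \<Rightarrow> 'b :: real_normed_vector"
    by (rule has_sum_finite_neutralI[OF finite_D_roots D_roots_subset])
      (auto simp: z scaleR_sum_right intro!: sum.cong)
  have zero: "(16 * pi\<^sup>2 * (real CARD('n) - 1) * \<alpha>) *\<^sub>R mat 1
      - (4 * pi\<^sup>2) *\<^sub>R \<alpha> *\<^sub>R (\<Sum>u\<in>D_roots. outer_square u) = (0 :: real^'n^'n)"
    by (simp add: sum_D_roots_outer_square mult_ac)
  have "0 \<in> (psd_cone :: (real^'n^'n) set)"
    by (simp add: psd_cone_def transpose_def vec_eq_iff)
  moreover have "(\<lambda>u. norm (z u)) summable_on D_lattice"
    by (rule summable_on_cong_neutral[THEN iffD1, OF _ _ _ summable_on_finite[OF finite_D_roots, of "\<lambda>u. norm (z u)"]])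
      (use D_roots_subset in \<open>auto simp: z\<close>)
  moreover have "z u = z (- u) \<and> z u \<in> \<real>\<^sub>\<ge>\<^sub>0" for u
    using uminus_D_roots[of u] uminus_D_roots[of "- u"] \<alpha> by (auto simp: z complex_nonneg_Reals_iff)
  moreover have "(norm x)\<^sup>2 \<le> 2 * (\<Sum>\<^sub>\<infinity>u\<in>D_lattice. Re (z u) * (1 - cos (2 * pi * (u \<bullet> x))))"
    if "x \<in> voronoi_cell (dual_lattice D_lattice)" for x :: "real^'n"
    using bound[OF that] infsumI[OF sums[of "\<lambda>u. 1 - cos (2 * pi * (u \<bullet> x))"]]
    by (simp add: root_energy_def)
  ultimately show ?thesis
    using \<alpha> has_sum_imp_summable[OF sums[of outer_square]]
    unfolding feasible_def dual_dual_D_lattice infsumI[OF sums[of outer_square]] zero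
    by (simp add: Suc_leI)
qed

section \<open>The maximal ratio is attained\<close>

lemma one_minus_cos_le: "1 - cos t \<le> t\<^sup>2 / 2" for t :: real
proof -
  have "1 - cos t = 2 * (sin (t / 2))\<^sup>2"
    using cos_double_sin[of "t / 2"] by simp
  also have "\<dots> \<le> 2 * (t / 2)\<^sup>2"
    using abs_sin_x_le_abs_x[of "t / 2"] by (intro mult_left_mono) (simp_all only: abs_le_square_iff)
  finally show ?thesis
    by (simp add: power2_eq_square)
qed

text \<open>
  Together with the quadratic upper bound this gives the behaviour of the root energy at 0 up to an
  error of order \<open>(norm x)\<^sup>4\<close>.
\<close>

lemma one_minus_cos_ge: "t\<^sup>2 / 2 - t ^ 4 / 24 \<le> 1 - cos t" for t :: real
proof -
  obtain s where "cos t = (\<Sum>m<4. cos_coeff m * t ^ m) + (cos (s + 1/2 * real 4 * pi) / fact 4) * t ^ 4"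
    using Maclaurin_cos_expansion by blast
  moreover have "{..<4} = {0, 1, 2, 3 :: nat}"
    by auto
  then have "(\<Sum>m<4. cos_coeff m * t ^ m) = 1 - t\<^sup>2 / 2"
    by (simp add: cos_coeff_def)
  moreover have "(cos (s + 1/2 * real 4 * pi) / fact 4) * t ^ 4 \<le> (1 / fact 4) * t ^ 4"
    by (intro mult_right_mono divide_right_mono) auto
  moreover have "fact 4 = (24 :: real)"
    by (simp add: eval_nat_numeral)
  ultimately show ?thesis
    by simp
qed

lemma sum_D_roots_half_square:
  "(\<Sum>u\<in>D_roots. (2 * pi * (u \<bullet> x))\<^sup>2 / 2) = 8 * pi\<^sup>2 * (real CARD('n) - 1) * (norm x)\<^sup>2"
  for x :: "real^'n"
proof -
  have "(\<Sum>u\<in>D_roots. (2 * pi * (u \<bullet> x))\<^sup>2 / 2) = 2 * pi\<^sup>2 * (\<Sum>u\<in>D_roots. (u \<bullet> x)\<^sup>2)"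
    by (simp add: sum_distrib_left power_mult_distrib mult_ac)
  then show ?thesis
    by (simp add: sum_D_roots_inner_square)
qed

lemma root_energy_le:
  "root_energy x \<le> 8 * pi\<^sup>2 * (real CARD('n) - 1) * (norm x)\<^sup>2" for x :: "real^'n"
  unfolding root_energy_def sum_D_roots_half_square[symmetric]
  by (intro sum_mono one_minus_cos_le)

lemma root_energy_ge:
  "8 * pi\<^sup>2 * (real CARD('n) - 1) * (norm x)\<^sup>2 - (\<Sum>u\<in>D_roots. (2 * pi * norm (u :: real^'n)) ^ 4 / 24) * norm x ^ 4
    \<le> root_energy x" for x :: "real^'n"
proof -
  have "(\<Sum>u\<in>D_roots. (2 * pi * (u \<bullet> x))\<^sup>2 / 2) - (\<Sum>u\<in>D_roots. (2 * pi * norm (u :: real^'n)) ^ 4 / 24) * norm x ^ 4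
      = (\<Sum>u\<in>D_roots. (2 * pi * (u \<bullet> x))\<^sup>2 / 2 - (2 * pi * norm u * norm x) ^ 4 / 24)"
    by (simp add: sum_subtractf sum_distrib_right power_mult_distrib mult.assoc)
  also have "\<dots> \<le> root_energy x"
    unfolding root_energy_def
  proof (rule sum_mono)
    fix u :: "real^'n"
    have "\<bar>2 * pi * (u \<bullet> x)\<bar> \<le> 2 * pi * norm u * norm x"
      using Cauchy_Schwarz_ineq2[of u x] by (simp add: abs_mult)
    then have "\<bar>2 * pi * (u \<bullet> x)\<bar> ^ 4 \<le> (2 * pi * norm u * norm x) ^ 4"
      by (intro power_mono) auto
    then show "(2 * pi * (u \<bullet> x))\<^sup>2 / 2 - (2 * pi * norm u * norm x) ^ 4 / 24
        \<le> 1 - cos (2 * pi * (u \<bullet> x))"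
      using one_minus_cos_ge[of "2 * pi * (u \<bullet> x)"] by (simp add: power_even_abs)
  qed
  finally show ?thesis
    unfolding sum_D_roots_half_square .
qed

text \<open>
  The reciprocal of the ratio that defines \<open>\<alpha>\<close>. The value at 0 is its limit there, since the root
  energy is asymptotic to \<open>8 * pi\<^sup>2 * (real CARD('n) - 1) * (norm x)\<^sup>2\<close>.
\<close>

definition inverse_ratio :: "real^'n \<Rightarrow> real" where
  "inverse_ratio x = (if x = 0 then 16 * pi\<^sup>2 * (real CARD('n) - 1)
     else 2 * root_energy x / (norm x)\<^sup>2)"

lemma inverse_ratio_le: "inverse_ratio x \<le> inverse_ratio (0 :: real^'n)" for x :: "real^'n"
  using root_energy_le[of x] by (auto simp: inverse_ratio_def divide_le_eq mult_ac)

lemma inverse_ratio_ge: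
  fixes x :: "real^'n"
  defines "K \<equiv> \<Sum>u\<in>D_roots. (2 * pi * norm (u :: real^'n)) ^ 4 / 24"
  shows "inverse_ratio (0 :: real^'n) - 2 * K * (norm x)\<^sup>2 \<le> inverse_ratio x"
proof (cases "x = 0")
  case False
  have "8 * pi\<^sup>2 * (real CARD('n) - 1) * (norm x)\<^sup>2 - K * ((norm x)\<^sup>2 * (norm x)\<^sup>2) \<le> root_energy x"
    using root_energy_ge[of x, folded K_def] by (simp add: power2_eq_square power4_eq_xxxx mult_ac)
  then have "(16 * pi\<^sup>2 * (real CARD('n) - 1) - 2 * K * (norm x)\<^sup>2) * (norm x)\<^sup>2 \<le> 2 * root_energy x"
    by (simp add: algebra_simps)
  then show ?thesis
    using False by (simp add: inverse_ratio_def le_divide_eq)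
qed (simp add: inverse_ratio_def)

lemma continuous_inverse_ratio: "continuous_on S inverse_ratio"
proof (rule continuous_at_imp_continuous_on, rule ballI)
  fix x :: "real^'n"
  show "isCont inverse_ratio x"
  proof (cases "x = 0")
    case True
    define K where "K = (\<Sum>u\<in>D_roots. (2 * pi * norm (u :: real^'n)) ^ 4 / 24)"
    have "((\<lambda>y. inverse_ratio (0 :: real^'n) - 2 * K * (norm y)\<^sup>2)
        \<longlongrightarrow> inverse_ratio (0 :: real^'n) - 2 * K * (norm (0::real^'n))\<^sup>2) (at (0::real^'n))"
      by (intro tendsto_intros)
    then have lower: "((\<lambda>y. inverse_ratio (0 :: real^'n) - 2 * K * (norm y)\<^sup>2)
        \<longlongrightarrow> inverse_ratio (0 :: real^'n)) (at (0::real^'n))"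
      by simp
    have "((\<lambda>y :: real^'n. inverse_ratio y) \<longlongrightarrow> inverse_ratio (0 :: real^'n)) (at 0)"
    proof (rule tendsto_sandwich[OF _ _ lower tendsto_const[of "inverse_ratio (0 :: real^'n)"]])
      show "\<forall>\<^sub>F y in at 0. inverse_ratio (0 :: real^'n) - 2 * K * (norm y)\<^sup>2 \<le> inverse_ratio (y :: real^'n)"
        unfolding K_def by (intro always_eventually allI inverse_ratio_ge)
      show "\<forall>\<^sub>F y in at 0. inverse_ratio (y :: real^'n) \<le> inverse_ratio (0 :: real^'n)"
        by (intro always_eventually allI inverse_ratio_le)
    qed
    then show ?thesis
      using True by (simp add: isCont_def)
  next
    case False
    then have "isCont (\<lambda>y. 2 * (\<Sum>u\<in>D_roots. 1 - cos (2 * pi * (u \<bullet> y))) / (norm y)\<^sup>2) x"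
      by (intro continuous_intros) auto
    moreover have "\<forall>\<^sub>F y in nhds x. inverse_ratio y
        = 2 * (\<Sum>u\<in>D_roots. 1 - cos (2 * pi * (u \<bullet> y))) / (norm y)\<^sup>2"
      using t1_space_nhds[OF False]
      by (rule eventually_mono) (simp add: inverse_ratio_def root_energy_def)
    ultimately show ?thesis
      by (simp add: isCont_cong)
  qed
qed

lemma closed_voronoi_cell: "closed (voronoi_cell L)"
proof -
  have "voronoi_cell L = (\<Inter>v\<in>L. {x. norm x \<le> norm (x - v)})"
    by (auto simp: voronoi_cell_def)
  then show ?thesis
    by (auto intro!: closed_INT closed_Collect_le continuous_intros)
qed

lemma compact_voronoi_cell_dual_D_lattice:
  "compact (voronoi_cell (dual_lattice (D_lattice :: (real^'n) set)))"
proof -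
  have "norm x \<le> real CARD('n)" if x: "x \<in> voronoi_cell (dual_lattice D_lattice)" for x :: "real^'n"
  proof -
    have "\<bar>x $ i\<bar> \<le> 1" for i
    proof -
      have "2 * (x \<bullet> axis i a) \<le> axis i a \<bullet> axis i a" if "a \<in> \<int>" for a
        using x axis_in_dual_D_lattice[OF that] unfolding mem_voronoi_cell_iff by blast
      from this[of 1] this[of "-1"] show ?thesis
        by (simp add: inner_axis inner_axis_axis)
    qed
    then have "(\<Sum>i\<in>UNIV. \<bar>x $ i\<bar>) \<le> (\<Sum>i\<in>(UNIV::'n set). 1)"
      by (intro sum_mono)
    with norm_le_l1_cart[of x] show ?thesis
      by simp
  qed
  then have "bounded (voronoi_cell (dual_lattice (D_lattice :: (real^'n) set)))"
    by (rule boundedI)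
  with closed_voronoi_cell show ?thesis
    by (simp add: compact_eq_bounded_closed)
qed

text \<open>
  The coordinate \<open>c\<close> of a dual lattice vector is half-integral, and such numbers satisfy
  \<open>c / 2 \<le> c\<^sup>2\<close>.
\<close>

lemma quarter_axis_in_voronoi_cell:
  "axis i (1 / 4) \<in> voronoi_cell (dual_lattice (D_lattice :: (real^'n) set))"
  unfolding mem_voronoi_cell_iff
proof
  fix v :: "real^'n" assume "v \<in> dual_lattice D_lattice"
  then obtain m :: int where m: "2 * v $ i = of_int m"
    using dual_D_lattice_half_integral[of v i] by (auto elim: Ints_cases)
  have "m \<le> m * m"
    by (cases "m \<le> 0") (auto intro: order_trans[of m 0] simp: mult_nonpos_nonpos)
  then have "real_of_int m \<le> real_of_int m * real_of_int m"
    by (metis of_int_le_iff of_int_mult)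
  then have "v $ i / 2 \<le> v $ i * v $ i"
    unfolding m[symmetric] by simp
  also have "\<dots> \<le> v \<bullet> v"
    unfolding inner_vec_def using member_le_sum[of i UNIV "\<lambda>i. v $ i * v $ i"] by simp
  finally show "2 * (axis i (1 / 4) \<bullet> v) \<le> v \<bullet> v"
    by (simp add: inner_axis')
qed

text \<open>
  The set \<open>V - {0}\<close> is not compact, but \<open>inverse_ratio\<close> is continuous on the compact cell \<open>V\<close> and attains
  its minimum there. Its value at 0 is its global maximum, so if the minimum is attained at 0, then
  the function is constant on \<open>V\<close> and any non-zero point of \<open>V\<close> serves as well.
\<close>

lemma ratio_attains_max:
  fixes V :: "(real^'n) set"
  assumes "2 \<le> CARD('n)" and V: "V = voronoi_cell (dual_lattice D_lattice)"
  shows "\<exists>m\<in>V - {0}. \<forall>x\<in>V - {0}. (norm x)\<^sup>2 / (2 * root_energy x) \<le> (norm m)\<^sup>2 / (2 * root_energy m)"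
proof -
  obtain i :: 'n where True
    by simp
  define q where "q = (axis i (1 / 4) :: real^'n)"
  have q: "q \<in> V - {0}"
    using quarter_axis_in_voronoi_cell by (simp add: V q_def axis_eq_0_iff)
  obtain m0 where m0: "m0 \<in> V" "\<And>x. x \<in> V \<Longrightarrow> inverse_ratio m0 \<le> inverse_ratio x"
    using continuous_attains_inf[OF _ _ continuous_inverse_ratio, of V] q
      compact_voronoi_cell_dual_D_lattice V by blast
  define m where "m = (if m0 = 0 then q else m0)"
  have m: "m \<in> V - {0}"
    using m0 q by (auto simp: m_def)
  have min: "inverse_ratio m \<le> inverse_ratio x" if "x \<in> V" for x
    using m0(2)[OF that] inverse_ratio_le[of q] by (auto simp: m_def split: if_splits)
  have ratio: "(norm x)\<^sup>2 / (2 * root_energy x) = 1 / inverse_ratio x" if "x \<in> V - {0}" for x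
    using that by (simp add: inverse_ratio_def)
  have pos: "0 < inverse_ratio x" if "x \<in> V - {0}" for x
    using that root_energy_pos[OF assms(1), of x] V by (simp add: inverse_ratio_def)
  have "(norm x)\<^sup>2 / (2 * root_energy x) \<le> (norm m)\<^sup>2 / (2 * root_energy m)" if "x \<in> V - {0}" for x
    unfolding ratio[OF that] ratio[OF m]
    using min[of x] pos[OF m] that by (intro divide_left_mono) auto
  then show ?thesis
    using m by blast
qed

section \<open>Optimality\<close>

theorem theorem7p1:
  fixes L :: "(real^'n) set"
    and ratios :: "real set"
    and \<alpha> C :: real
    and z :: "real^'n \<Rightarrow> complex"
  assumes "2 \<le> CARD('n)"
    and "L = dual_lattice D_lattice"
    and "ratios = {(norm x)\<^sup>2 / (2 * (\<Sum>u\<in>D_roots. 1 - cos (2 * pi * (u \<bullet> x)))) | x.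
                     x \<in> voronoi_cell L - {0}}"
    and "\<alpha> = (GREATEST a. a \<in> ratios)"
    and "C = 16 * pi\<^sup>2 * (real CARD('n) - 1) * \<alpha>"
    and "z = (\<lambda>u. if u \<in> D_roots then complex_of_real \<alpha> else 0)"
  shows "dual_lattice L = D_lattice \<and>
         (\<alpha> \<in> ratios \<and> (\<forall>a\<in>ratios. a \<le> \<alpha>)) \<and>
         optimal_solution L C z"
proof -
  define V where "V = voronoi_cell L"
  have V: "V = voronoi_cell (dual_lattice D_lattice)"
    by (simp add: V_def assms(2))
  have ratios: "ratios = (\<lambda>x. (norm x)\<^sup>2 / (2 * root_energy x)) ` (V - {0})"
    unfolding assms(3) V_def root_energy_def by blast
  obtain m where m: "m \<in> V - {0}"
    and max: "\<And>x. x \<in> V - {0} \<Longrightarrow> (norm x)\<^sup>2 / (2 * root_energy x) \<le> (norm m)\<^sup>2 / (2 * root_energy m)"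
    using ratio_attains_max[OF assms(1) V] by blast
  have \<alpha>: "\<alpha> = (norm m)\<^sup>2 / (2 * root_energy m)"
    unfolding assms(4) by (rule Greatest_equality) (use m max in \<open>auto simp: ratios\<close>)
  have pos: "0 < root_energy x" if "x \<in> V - {0}" for x
    using that root_energy_pos[OF assms(1), of x] V by simp
  have bound: "(norm x)\<^sup>2 \<le> 2 * \<alpha> * root_energy x" if "x \<in> V" for x
  proof (cases "x = 0")
    case False
    then have "(norm x)\<^sup>2 / (2 * root_energy x) \<le> \<alpha>" "0 < root_energy x"
      using that max[of x] pos[of x] \<alpha> by auto
    then show ?thesis
      by (simp add: divide_le_eq mult_ac)
  qed (simp add: root_energy_def)
  have "0 \<le> \<alpha>"
    unfolding \<alpha> by (simp add: root_energy_nonneg)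
  then have "feasible L C z"
    unfolding assms(2,5) using bound V by (intro root_weights_feasible assms(6)) auto
  moreover have "C \<le> C'" if "feasible L C' z'" for C' z'
  proof -
    have "8 * pi\<^sup>2 * (real CARD('n) - 1) * (norm m)\<^sup>2 \<le> C' * root_energy m"
      using that m unfolding assms(2) V by (intro feasible_lower_bound assms(1)) auto
    then have "8 * pi\<^sup>2 * (real CARD('n) - 1) * (norm m)\<^sup>2 / root_energy m \<le> C'"
      using pos[OF m] by (simp add: divide_le_eq)
    then show ?thesis
      by (simp add: assms(5) \<alpha> mult_ac)
  qed
  moreover have "\<alpha> \<in> ratios \<and> (\<forall>a\<in>ratios. a \<le> \<alpha>)"
    using m max by (auto simp: ratios \<alpha>)
  ultimately show ?thesis
    using dual_dual_D_lattice assms(2) by (simp add: optimal_solution_def)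
qed

end
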